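(* For every positive integer $n$, the complete bipartite graph $K_{3n,3n}$ satisfies $\operatorname{pf}(K_{3n,3n}) \geq 3n+1$. In particular, the pfaffian number of graphs is unbounded: for every integer $N$ there is a graph $G$ with $\operatorname{pf}(G) \geq N$.
   Context: Graphs are finite and simple. Given an orientation $D$ of a graph $G$ with vertices enumerated $1,\dots,2m$ and a perfect matching $M$ of $G$, $\operatorname{sign}_D(M)\in\{1,-1\}$ is the sign of the permutation $\begin{pmatrix}1&2&\cdots&2m-1&2m\\ u_1&v_1&\cdots&u_m&v_m\end{pmatrix}$, where the edges of $M$ are $u_iv_i$, oriented in $D$ from $u_i$ to $v_i$ (independent of the order in which the edges are listed). For a positive integer $k$, a $k$-orientation of $G$ is a vector $\mathbf{D}=(D_1,\dots,D_k)$ of orientations of $G$; for a perfect matching $M$, $\mathbf{sign}_{\mathbf{D}}(M) := (\operatorname{sign}_{D_1}(M),\dots,\operatorname{sign}_{D_k}(M))$, and the signature matrix $\mathbf{sign}_{\mathbf{D}}$ has these vectors as rows, one row for each perfect matching $M$ of $G$. $\mathbf{D}$ is pfaffian if $\mathbf{sign}_{\mathbf{D}}\,\mathbf{x}=\mathbf{1}$ has a solution $\mathbf{x}\in\mathbb{R}^k$. $G$ is $k$-pfaffian if it admits a pfaffian $k$-orientation (independent of the enumeration of the vertices). The pfaffian number $\operatorname{pf}(G)$ is the smallest positive integer $k$ such that $G$ is $k$-pfaffian (it always exists). *)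

theory Defs
  imports
    "HOL-Analysis.Analysis"
    "HOL-Combinatorics.Permutations"
    "Graph_Theory.Graph_Theory"
begin

text \<open>
  Finite simple graphs are the \<^locale>\<open>pair_graph\<close> digraphs of Graph\_Theory: every edge
  \<open>uv\<close> is present as the two arcs \<open>(u,v)\<close> and \<open>(v,u)\<close>. Sets of edges, such as matchings,
  are accordingly symmetric sets of arcs, while an orientation contains exactly one of the
  two arcs of each edge. So for an orientation \<open>D\<close> and an edge set \<open>M\<close>, the set
  \<open>M \<inter> D\<close> consists of the edges of \<open>M\<close> directed as in \<open>D\<close>.
\<close>

definition orientation :: "'a pair_pre_digraph \<Rightarrow> 'a rel \<Rightarrow> bool" where
  "orientation G D \<longleftrightarrow>
     D \<subseteq> parcs G \<and> (\<forall>(u, v) \<in> parcs G. (u, v) \<in> D \<longleftrightarrow> (v, u) \<notin> D)"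

definition perfect_matching :: "'a pair_pre_digraph \<Rightarrow> 'a rel \<Rightarrow> bool" where
  "perfect_matching G M \<longleftrightarrow>
     M \<subseteq> parcs G \<and> sym M \<and> (\<forall>u \<in> pverts G. \<exists>!v. (u, v) \<in> M)"

definition vertex_enum :: "'a pair_pre_digraph \<Rightarrow> (nat \<Rightarrow> 'a) \<Rightarrow> bool" where
  "vertex_enum G e \<longleftrightarrow> bij_betw e {1..card (pverts G)} (pverts G)"

text \<open>
  \<open>p\<close> is the permutation with second row \<open>u\<^sub>1 v\<^sub>1 \<dots> u\<^sub>m v\<^sub>m\<close> for some listing
  \<open>u\<^sub>1v\<^sub>1, \<dots>, u\<^sub>mv\<^sub>m\<close> of the edges of \<open>M\<close>, each directed from \<open>u\<^sub>i\<close> to \<open>v\<^sub>i\<close> in \<open>D\<close>,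
  where the vertex \<open>e j\<close> is identified with its number \<open>j\<close>.
\<close>

definition listing_perm ::
  "'a pair_pre_digraph \<Rightarrow> (nat \<Rightarrow> 'a) \<Rightarrow> 'a rel \<Rightarrow> 'a rel \<Rightarrow> (nat \<Rightarrow> nat) \<Rightarrow> bool" where
  "listing_perm G e D M p \<longleftrightarrow>
     p permutes {1..card (pverts G)} \<and>
     M \<inter> D = {(e (p (2 * i - 1)), e (p (2 * i))) | i. i \<in> {1..card (pverts G) div 2}}"

text \<open>
  The sign does not depend on the listing: reordering the edges changes the permutation
  by an even one.
\<close>

definition sign_matching ::
  "'a pair_pre_digraph \<Rightarrow> (nat \<Rightarrow> 'a) \<Rightarrow> 'a rel \<Rightarrow> 'a rel \<Rightarrow> int" where
  "sign_matching G e D M = sign (SOME p. listing_perm G e D M p)"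

definition k_orientation :: "'a pair_pre_digraph \<Rightarrow> nat \<Rightarrow> 'a rel list \<Rightarrow> bool" where
  "k_orientation G k Ds \<longleftrightarrow> length Ds = k \<and> (\<forall>D \<in> set Ds. orientation G D)"

text \<open>The entry of the signature matrix in row \<open>M\<close> and column \<open>i\<close> (counted from \<open>0\<close>).\<close>

definition signature ::
  "'a pair_pre_digraph \<Rightarrow> (nat \<Rightarrow> 'a) \<Rightarrow> 'a rel list \<Rightarrow> 'a rel \<Rightarrow> nat \<Rightarrow> real" where
  "signature G e Ds M i = of_int (sign_matching G e (Ds ! i) M)"

text \<open>Only the entries \<open>x 0, \<dots>, x (k - 1)\<close> of the solution matter.\<close>

definition pfaffian_orientation ::
  "'a pair_pre_digraph \<Rightarrow> (nat \<Rightarrow> 'a) \<Rightarrow> nat \<Rightarrow> 'a rel list \<Rightarrow> bool" where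
  "pfaffian_orientation G e k Ds \<longleftrightarrow>
     k_orientation G k Ds \<and>
     (\<exists>x :: nat \<Rightarrow> real. \<forall>M. perfect_matching G M \<longrightarrow> (\<Sum>i<k. signature G e Ds M i * x i) = 1)"

text \<open>
  Changing the enumeration multiplies every sign by one common factor, so it makes no
  difference whether some or every enumeration is required to work.
\<close>

definition k_pfaffian :: "'a pair_pre_digraph \<Rightarrow> nat \<Rightarrow> bool" where
  "k_pfaffian G k \<longleftrightarrow> (\<exists>e Ds. vertex_enum G e \<and> pfaffian_orientation G e k Ds)"

definition pf :: "'a pair_pre_digraph \<Rightarrow> nat" where
  "pf G = (LEAST k. k > 0 \<and> k_pfaffian G k)"

end

theory Submission
  imports Defs
begin

text \<open>
  For an orientation \<open>D\<close> of \<open>K\<^sub>N\<^sub>,\<^sub>N\<close> let \<open>s\<^sub>D(i,j) = \<plusminus>1\<close> tell the direction of the edge \<open>u\<^sub>i w\<^sub>j\<close>.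
  Perfect matchings are permutations \<open>\<sigma>\<close>, and up to a global factor the sign of \<open>\<sigma>\<close> is
  \<open>sgn \<sigma> \<cdot> \<Prod>\<^sub>i s\<^sub>D(i, \<sigma> i)\<close> (\<open>sign_matching_matching_of\<close>). So a pfaffian \<open>k\<close>-orientation is a
  relation \<open>\<Sum>\<^sub>i x\<^sub>i f\<^sub>i = 1\<close> between \<open>k\<close> functions of this form on the permutations.

  That \<open>k \<ge> 3n+1\<close> when \<open>N = 3n\<close> is proved by induction on \<open>n\<close>
  (\<open>signed_permutation_products_lower_bound\<close>); for \<open>n = 0\<close> it holds because an empty sum is not
  \<open>1\<close>. Restrict to the permutations that preserve a block of three
  indices: each function becomes a product \<open>g\<^sub>i(\<sigma>) h\<^sub>i(t)\<close> where \<open>t\<close> runs through the six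
  permutations of the block. The six values of \<open>h\<^sub>i\<close> multiply to \<open>-1\<close>
  (\<open>six_permutations_of_three\<close>), and at most three such sign vectors never have the constant vector
  \<open>1\<close> in their span (\<open>odd_sign_vectors_not_spanning_one\<close>). Hence for any three indices \<open>i\<close> some
  functional annihilates the three vectors \<open>h\<^sub>i\<close> but maps the constant vector to \<open>1\<close>
  (\<open>linear_alternative\<close>), and applying it to the relation eliminates three functions together with
  three rows of the matrix.

  The pfaffian number is a minimum, so it must also be shown that some \<open>k\<close> works
  (\<open>exists_k_pfaffian\<close>); this is an inclusion-exclusion over the edges of each perfect matching
  (\<open>signed_permutation_products_span_one\<close>).
\<close>

section \<open>Linear algebra over sign vectors\<close>

text \<open>
  Fredholm alternative: a vector that is not a combination of finitely many given ones is
  separated from them by a linear functional.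
\<close>

lemma linear_alternative:
  fixes h :: "'i \<Rightarrow> 't::finite \<Rightarrow> real" and v :: "'t \<Rightarrow> real"
  assumes "finite Z"
  shows "(\<exists>u. \<forall>t. (\<Sum>i\<in>Z. u i * h i t) = v t) \<or>
         (\<exists>c. (\<forall>i\<in>Z. (\<Sum>t\<in>UNIV. c t * h i t) = 0) \<and> (\<Sum>t\<in>UNIV. c t * v t) = 1)"
proof -
  define H :: "'i \<Rightarrow> real^'t" where "H i = (\<chi> t. h i t)" for i
  define V :: "real^'t" where "V = (\<chi> t. v t)"
  obtain y z where y: "y \<in> span (H ` Z)"
    and z: "\<And>w. w \<in> span (H ` Z) \<Longrightarrow> orthogonal z w" and V: "V = y + z"
    using orthogonal_subspace_decomp_exists by blast
  show ?thesis
  proof (cases "z = 0")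
    case True
    have "\<exists>u. y = (\<Sum>i\<in>Z. u i *\<^sub>R H i)"
      using y
    proof (induction rule: span_induct_alt)
      case base
      show ?case by (rule exI[of _ "\<lambda>_. 0"]) simp
    next
      case (step a g w)
      then obtain i u where i: "i \<in> Z" "g = H i" and u: "w = (\<Sum>i\<in>Z. u i *\<^sub>R H i)"
        by blast
      have "a *\<^sub>R g = (\<Sum>j\<in>Z. (if j = i then a else 0) *\<^sub>R H j)"
        using i assms by (simp add: if_distrib[of "\<lambda>r. r *\<^sub>R _"] sum.delta cong: if_cong)
      then have "a *\<^sub>R g + w = (\<Sum>j\<in>Z. ((if j = i then a else 0) + u j) *\<^sub>R H j)"
        by (simp only: u scaleR_add_left sum.distrib)
      then show ?case
        by (rule exI[of _ "\<lambda>j. (if j = i then a else 0) + u j"])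
    qed
    then obtain u where "V = (\<Sum>i\<in>Z. u i *\<^sub>R H i)"
      using V True by auto
    then have "V $ t = (\<Sum>i\<in>Z. u i *\<^sub>R H i) $ t" for t
      by simp
    then show ?thesis
      by (auto simp: V_def H_def intro!: exI[of _ u])
  next
    case False
    \<comment> \<open>The functional is the inner product with the component of \<open>v\<close> orthogonal to the span, normalised.\<close>
    define c where "c t = z $ t / (z \<bullet> z)" for t
    have c: "(\<Sum>t\<in>UNIV. c t * w $ t) = (z \<bullet> w) / (z \<bullet> z)" for w :: "real^'t"
      by (simp add: c_def inner_vec_def sum_divide_distrib)
    have "(\<Sum>t\<in>UNIV. c t * h i t) = 0" if "i \<in> Z" for i
      using c[of "H i"] z[of "H i"] that by (simp add: H_def span_base orthogonal_def)
    moreover have "z \<bullet> V = z \<bullet> z"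
      using z[OF y] by (simp add: V inner_add_right orthogonal_def)
    then have "(\<Sum>t\<in>UNIV. c t * v t) = 1"
      using c[of V] False by (simp add: V_def)
    ultimately show ?thesis
      by blast
  qed
qed

text \<open>
  Take a sign vector of even length to be odd if its entries have product \<open>-1\<close>. A relation
  \<open>\<Sum>\<^sub>i u\<^sub>i h\<^sub>i = 1\<close> between at most three odd sign vectors is impossible: between two
  coordinates the vectors that change sign have weighted sum \<open>0\<close>. Within the support of \<open>u\<close> these
  are therefore neither a single vector nor all vectors, so none or exactly two, and the product
  over the support of the entries at a coordinate is the same for all coordinates. Multiplying over
  all coordinates, of which there are evenly many, shows that the size of the support is even,
  hence two; then nothing changes at all and a vector in the support is constant, which
  contradicts oddness.
\<close>

lemma odd_sign_vectors_not_spanning_one: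
  fixes h :: "'i \<Rightarrow> 't::finite \<Rightarrow> real"
  assumes T: "even CARD('t)" and Z: "finite Z" "card Z \<le> 3"
    and pm: "\<And>i t. i \<in> Z \<Longrightarrow> h i t \<in> {1, -1}"
    and odd: "\<And>i. i \<in> Z \<Longrightarrow> (\<Prod>t\<in>UNIV. h i t) = -1"
  shows "\<not> (\<forall>t. (\<Sum>i\<in>Z. u i * h i t) = 1)"
proof
  assume *: "\<forall>t. (\<Sum>i\<in>Z. u i * h i t) = 1"
  define I where "I = {i\<in>Z. u i \<noteq> 0}"
  have I: "finite I" "I \<subseteq> Z" "card I \<le> 3"
    using Z card_mono[of Z I] by (auto simp: I_def)
  have one: "(\<Sum>i\<in>I. u i * h i t) = 1" for t
  proof -
    have "(\<Sum>i\<in>I. u i * h i t) = (\<Sum>i\<in>Z. u i * h i t)"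
      by (rule sum.mono_neutral_left) (use Z in \<open>auto simp: I_def\<close>)
    then show ?thesis using * by simp
  qed
  define D where "D t t' = {i\<in>I. h i t \<noteq> h i t'}" for t t'
  have D: "D t t' \<subseteq> I" "finite (D t t')" for t t'
    using I by (auto simp: D_def)
  have flip: "h i t' = - h i t" if "i \<in> D t t'" for i t t'
    using that pm[of i t] pm[of i t'] subsetD[OF I(2), of i] by (auto simp: D_def)
  \<comment> \<open>Subtracting the relations at \<open>t\<close> and \<open>t'\<close> leaves the vectors that change sign.\<close>
  have D0: "(\<Sum>i\<in>D t t'. u i * h i t) = 0" for t t'
  proof -
    have "0 = (\<Sum>i\<in>I. u i * h i t - u i * h i t')"
      using one by (simp add: sum_subtractf)
    also have "\<dots> = (\<Sum>i\<in>D t t'. u i * h i t - u i * h i t')"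
      by (rule sum.mono_neutral_right) (use I in \<open>auto simp: D_def\<close>)
    also have "\<dots> = (\<Sum>i\<in>D t t'. 2 * (u i * h i t))"
      by (rule sum.cong) (auto simp: flip)
    finally show ?thesis by (simp flip: sum_distrib_left)
  qed
  have DI: "D t t' \<noteq> I" for t t'
    using D0[of t t'] one[of t] by auto
  have D1: "card (D t t') \<noteq> 1" for t t'
  proof
    assume "card (D t t') = 1"
    then obtain i where i: "D t t' = {i}" by (rule card_1_singletonE)
    then have "u i \<noteq> 0" "h i t \<noteq> 0"
      using D[of t t'] I pm[of i t] by (auto simp: I_def)
    then show False using D0[of t t'] i by simp
  qed
  have Dcard: "card (D t t') < card I" for t t'
    using D DI I by (meson psubset_card_mono psubsetI)
  have Dc: "card (D t t') = 0 \<or> card (D t t') = 2" for t t'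
    using Dcard[of t t'] D1[of t t'] I(3) by linarith
  define P where "P t = (\<Prod>i\<in>I. h i t)" for t
  have const: "P t = P t'" for t t'
  proof -
    have "P t' = (\<Prod>i\<in>I - D t t'. h i t') * (\<Prod>i\<in>D t t'. h i t')"
      unfolding P_def using I D by (intro prod.subset_diff) auto
    also have "(\<Prod>i\<in>D t t'. h i t') = (\<Prod>i\<in>D t t'. - 1 * h i t)"
      by (rule prod.cong) (auto simp: flip)
    also have "\<dots> = (-1) ^ card (D t t') * (\<Prod>i\<in>D t t'. h i t)"
      by (simp only: prod.distrib prod_constant)
    also have "\<dots> = (\<Prod>i\<in>D t t'. h i t)"
      using Dc[of t t'] by auto
    also have "(\<Prod>i\<in>I - D t t'. h i t') = (\<Prod>i\<in>I - D t t'. h i t)"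
      by (rule prod.cong) (auto simp: D_def)
    also have "\<dots> * (\<Prod>i\<in>D t t'. h i t) = P t"
      unfolding P_def using I D by (intro prod.subset_diff[symmetric]) auto
    finally show ?thesis by simp
  qed
  have sq: "r ^ CARD('t) = 1" if "\<bar>r\<bar> = 1" for r :: real
    using T that by (metis power_even_abs power_one)
  have habs: "\<bar>h i t\<bar> = 1" if "i \<in> I" for i t
    using pm[of i t] subsetD[OF I(2) that] by auto
  fix t0
  have "(\<Prod>t\<in>UNIV. P t) = P t0 ^ CARD('t)"
    using const by (subst prod.cong[OF refl, of UNIV P "\<lambda>_. P t0"]) auto
  also have "\<dots> = 1"
    by (rule sq) (simp add: P_def abs_prod habs)
  finally have "(\<Prod>i\<in>I. \<Prod>t\<in>UNIV. h i t) = 1"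
    unfolding P_def by (subst prod.swap)
  moreover have "(\<Prod>i\<in>I. \<Prod>t\<in>UNIV. h i t) = (-1) ^ card I"
    using I odd by (subst prod.cong[OF refl, of I _ "\<lambda>_. -1"]) auto
  ultimately have ev: "even (card I)"
    by (simp add: minus_one_power_iff split: if_splits)
  then have "card I \<le> 2"
    using I(3) by (cases "card I = 3") auto
  then have "D t t' = {}" for t t'
    using Dc[of t t'] Dcard[of t t'] D(2)[of t t'] by auto
  then have hc: "h i t = h i t0" if "i \<in> I" for i t
    using that by (auto simp: D_def)
  have "I \<noteq> {}"
    using one[of t0] by auto
  then obtain i where i: "i \<in> I" by auto
  have "(\<Prod>t\<in>UNIV. h i t) = h i t0 ^ CARD('t)"
    by (subst prod.cong[OF refl hc[OF i]]) auto
  also have "\<dots> = 1"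
    by (rule sq) (rule habs[OF i])
  finally show False
    using odd[of i] i I by auto
qed

section \<open>Signed permutation products\<close>

text \<open>
  The \<open>3 \<times> 3\<close> case: among the six permutations three are odd, and each entry \<open>s j l\<close> is used by
  two of them, so the six signed products multiply to \<open>-1\<close>. The index type \<open>bool option \<times> bool\<close>
  serves as a type with six elements: \<open>(k, b)\<close> stands for a power of a 3-cycle, encoded by \<open>k\<close>, times
  a transposition if \<open>b\<close> holds.
\<close>

lemma six_permutations_of_three:
  fixes x y z :: 'a
  assumes xyz: "x \<noteq> y" "y \<noteq> z" "x \<noteq> z"
  shows "\<exists>\<beta> :: bool option \<times> bool \<Rightarrow> 'a \<Rightarrow> 'a. (\<forall>t. \<beta> t permutes {x, y, z}) \<and>
    (\<forall>s :: 'a \<Rightarrow> 'a \<Rightarrow> real. (\<forall>j l. s j l \<in> {1, -1}) \<longrightarrow>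
       (\<Prod>t\<in>UNIV. of_int (sign (\<beta> t)) * (\<Prod>j\<in>{x, y, z}. s j (\<beta> t j))) = -1)"
proof -
  define c where "c = Transposition.transpose x y \<circ> Transposition.transpose y z"
  define r where "r k = (case k of None \<Rightarrow> id | Some True \<Rightarrow> c | Some False \<Rightarrow> c \<circ> c)" for k
  define \<beta> where "\<beta> t = r (fst t) \<circ> (if snd t then Transposition.transpose x y else id)" for t
  have c: "c permutes {x, y, z}"
    unfolding c_def by (intro permutes_compose permutes_swap_id) auto
  have r: "r k permutes {x, y, z}" for k
    using c by (auto simp: r_def permutes_id intro!: permutes_compose split: option.splits bool.splits)
  have tr: "Transposition.transpose x y permutes {x, y, z}"
    by (rule permutes_swap_id) auto
  have perm: "permutation (r k)" "permutation c" for k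
    using r c by (auto intro!: permutes_imp_permutation[of "{x,y,z}"])
  have sc: "sign c = 1"
    using xyz by (simp add: c_def sign_compose permutation_swap_id sign_swap_id)
  have sr: "sign (r k) = 1" for k
    by (auto simp: r_def sign_compose perm sc split: option.splits bool.splits)
  have sb: "sign (\<beta> t) = (if snd t then -1 else 1)" for t
    using xyz by (auto simp: \<beta>_def sign_compose perm sr permutation_swap_id sign_swap_id)
  have U: "(UNIV :: (bool option \<times> bool) set) =
     {(None, True), (None, False), (Some True, True), (Some True, False), (Some False, True), (Some False, False)}"
    unfolding UNIV_Times_UNIV[symmetric] UNIV_option_conv UNIV_bool by auto
  have 1: "\<beta> t permutes {x, y, z}" for t
    using r tr by (auto simp: \<beta>_def intro!: permutes_compose)
  have cv: "c x = y" "c y = z" "c z = x"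
    using xyz by (auto simp: c_def Transposition.transpose_def)
  have 2: "(\<Prod>t\<in>UNIV. of_int (sign (\<beta> t)) * (\<Prod>j\<in>{x, y, z}. s j (\<beta> t j))) = -1"
    if s: "\<And>j l. s j l \<in> {1, -1}" for s :: "'a \<Rightarrow> 'a \<Rightarrow> real"
  proof -
    have sq: "s j l * s j l = 1" "s j l * (s j l * q) = q" for j l q
      using s[of j l] by auto
    show ?thesis
      unfolding U sb using xyz
      by (simp add: \<beta>_def r_def cv mult_ac sq)
  qed
  show ?thesis
    using 1 2 by (intro exI[of _ \<beta>]) blast
qed

text \<open>
  Induction on \<open>n\<close>. Split off three elements of \<open>S\<close>. On permutations that preserve the resulting
  partition each column is a tensor product \<open>g i \<sigma> * h i t\<close>, where every \<open>h i\<close> is an odd sign vector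
  of length six. For any three columns \<open>Z\<close> there is a functional \<open>c\<close> that annihilates \<open>h i\<close> for
  \<open>i \<in> Z\<close> and is \<open>1\<close> at the constant vector; applying it in the second factor gives a relation for
  \<open>S\<close> without those three elements that avoids the three columns.
\<close>

lemma signed_permutation_products_lower_bound:
  fixes s :: "'i \<Rightarrow> 'a \<Rightarrow> 'a \<Rightarrow> real"
  assumes "finite I" "finite S" "card S = 3 * n"
    and "\<And>i j l. s i j l \<in> {1, -1}"
    and "\<And>\<sigma>. \<sigma> permutes S \<Longrightarrow>
           (\<Sum>i\<in>I. x i * (of_int (sign \<sigma>) * (\<Prod>j\<in>S. s i j (\<sigma> j)))) = 1"
  shows "3 * n + 1 \<le> card I"
  using assms
proof (induction n arbitrary: I S x)
  case 0
  then show ?case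
    using "0.prems"(5)[of id] by (cases "I = {}") (auto simp: Suc_le_eq card_gt_0_iff)
next
  case (Suc n)
  note pm = Suc.prems(4)
  obtain S3 where S3: "S3 \<subseteq> S" "card S3 = 3"
    using obtain_subset_with_card_n[of 3 S] Suc.prems(3) by (metis le_add1 mult_Suc_right)
  then obtain a b c where abc: "S3 = {a, b, c}" "a \<noteq> b" "b \<noteq> c" "a \<noteq> c"
    unfolding card_3_iff by blast
  define S' where "S' = S - S3"
  have S': "finite S'" "card S' = 3 * n"
    using S3 Suc.prems(2,3) by (auto simp: S'_def card_Diff_subset finite_subset)
  obtain \<beta> :: "bool option \<times> bool \<Rightarrow> 'a \<Rightarrow> 'a" where
    \<beta>': "\<forall>t. \<beta> t permutes S3" and
    \<beta>_odd: "\<forall>s :: 'a \<Rightarrow> 'a \<Rightarrow> real. (\<forall>j l. s j l \<in> {1, -1}) \<longrightarrow>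
       (\<Prod>t\<in>UNIV. of_int (sign (\<beta> t)) * (\<Prod>j\<in>S3. s j (\<beta> t j))) = -1"
    using six_permutations_of_three[OF abc(2-4), folded abc(1)] by blast
  have \<beta>: "\<beta> t permutes S3" for t
    using \<beta>' by blast
  define h where "h i t = of_int (sign (\<beta> t)) * (\<Prod>j\<in>S3. s i j (\<beta> t j))" for i t
  define g where "g i \<sigma> = of_int (sign \<sigma>) * (\<Prod>j\<in>S'. s i j (\<sigma> j))" for i and \<sigma> :: "'a \<Rightarrow> 'a"
  have gh: "(\<Sum>i\<in>I. x i * (g i \<sigma> * h i t)) = 1" if \<sigma>: "\<sigma> permutes S'" for \<sigma> t
  proof -
    have perm: "permutation \<sigma>" "permutation (\<beta> t)"
      using permutes_imp_permutation[OF S'(1) \<sigma>] permutes_imp_permutation[OF finite_subset[OF S3(1) Suc.prems(2)] \<beta>]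
      by auto
    have "\<sigma> \<circ> \<beta> t permutes S"
      using \<sigma> \<beta>[of t] S3 by (intro permutes_compose) (auto simp: S'_def elim!: permutes_subset)
    note Suc.prems(5)[OF this]
    moreover have "of_int (sign (\<sigma> \<circ> \<beta> t)) * (\<Prod>j\<in>S. s i j ((\<sigma> \<circ> \<beta> t) j)) = g i \<sigma> * h i t" for i
    proof -
      have "(\<sigma> \<circ> \<beta> t) j = \<sigma> j" if "j \<in> S'" for j
        using that \<beta>[of t] by (auto simp: S'_def permutes_not_in)
      moreover have "(\<sigma> \<circ> \<beta> t) j = \<beta> t j" if "j \<in> S3" for j
        using that \<beta>[of t] \<sigma> by (auto simp: S'_def permutes_in_image intro!: permutes_not_in)
      ultimately have "(\<Prod>j\<in>S'. s i j ((\<sigma> \<circ> \<beta> t) j)) * (\<Prod>j\<in>S3. s i j ((\<sigma> \<circ> \<beta> t) j))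
          = (\<Prod>j\<in>S'. s i j (\<sigma> j)) * (\<Prod>j\<in>S3. s i j (\<beta> t j))"
        by simp
      moreover have "(\<Prod>j\<in>S. s i j ((\<sigma> \<circ> \<beta> t) j)) =
          (\<Prod>j\<in>S'. s i j ((\<sigma> \<circ> \<beta> t) j)) * (\<Prod>j\<in>S3. s i j ((\<sigma> \<circ> \<beta> t) j))"
        unfolding S'_def by (rule prod.subset_diff) (use S3 Suc.prems(2) in auto)
      ultimately show ?thesis
        by (simp add: g_def h_def sign_compose perm)
    qed
    ultimately show ?thesis by (simp only:)
  qed
  have hpm: "h i t \<in> {1, -1}" for i t
  proof -
    have "\<bar>s i j l\<bar> = 1" for j l using pm[of i j l] by auto
    then have "\<bar>h i t\<bar> = 1"
      by (simp add: h_def abs_mult abs_prod sign_def)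
    then show ?thesis by auto
  qed
  have hodd: "(\<Prod>t\<in>UNIV. h i t) = -1" for i
    unfolding h_def by (rule \<beta>_odd[rule_format]) (rule pm)
  have key: "\<exists>c. (\<forall>i\<in>Z. (\<Sum>t\<in>UNIV. c t * h i t) = 0) \<and> (\<Sum>t\<in>UNIV. c t) = 1"
    if "finite Z" "card Z \<le> 3" for Z
  proof -
    have "even CARD(bool option \<times> bool)"
      by simp
    then have "\<nexists>u. \<forall>t. (\<Sum>i\<in>Z. u i * h i t) = 1"
      using odd_sign_vectors_not_spanning_one[OF _ that, of h, OF _ hpm hodd] by blast
    then show ?thesis
      using linear_alternative[OF that(1), of h "\<lambda>_. 1"] unfolding mult_1_right by blast
  qed
  have reduce: "\<exists>y. \<forall>\<sigma>. \<sigma> permutes S' \<longrightarrow> (\<Sum>i\<in>I - Z. y i * g i \<sigma>) = 1"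
    if Z: "Z \<subseteq> I" "card Z \<le> 3" for Z
  proof -
    have "finite Z" using Z Suc.prems(1) finite_subset by blast
    then obtain c where c: "\<And>i. i \<in> Z \<Longrightarrow> (\<Sum>t\<in>UNIV. c t * h i t) = 0" "(\<Sum>t\<in>UNIV. c t) = 1"
      using key Z by blast
    define y where "y i = x i * (\<Sum>t\<in>UNIV. c t * h i t)" for i
    have "(\<Sum>i\<in>I - Z. y i * g i \<sigma>) = 1" if "\<sigma> permutes S'" for \<sigma>
    proof -
      have "(\<Sum>i\<in>I - Z. y i * g i \<sigma>) = (\<Sum>i\<in>I. y i * g i \<sigma>)"
        by (rule sum.mono_neutral_left) (use Suc.prems(1) c in \<open>auto simp: y_def\<close>)
      also have "\<dots> = (\<Sum>i\<in>I. \<Sum>t\<in>UNIV. c t * (x i * (g i \<sigma> * h i t)))"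
        by (simp add: y_def sum_distrib_left sum_distrib_right mult_ac)
      also have "\<dots> = (\<Sum>t\<in>UNIV. \<Sum>i\<in>I. c t * (x i * (g i \<sigma> * h i t)))"
        by (rule sum.swap)
      also have "\<dots> = 1"
        using gh[OF that] c(2) by (simp flip: sum_distrib_left)
      finally show ?thesis .
    qed
    then show ?thesis by blast
  qed
  have "card I \<ge> 3"
  proof (rule ccontr)
    assume "\<not> 3 \<le> card I"
    then obtain y where "\<forall>\<sigma>. \<sigma> permutes S' \<longrightarrow> (\<Sum>i\<in>I - I. y i * g i \<sigma>) = 1"
      using reduce[of I] by auto
    from this[rule_format, OF permutes_id] show False by simp
  qed
  then obtain Z where Z: "Z \<subseteq> I" "card Z = 3" "finite Z"
    by (rule obtain_subset_with_card_n)
  then obtain y where y: "\<And>\<sigma>. \<sigma> permutes S' \<Longrightarrow> (\<Sum>i\<in>I - Z. y i * g i \<sigma>) = 1"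
    using reduce[of Z] by auto
  have "3 * n + 1 \<le> card (I - Z)"
    by (rule Suc.IH[where S = S' and x = y]) (use Suc.prems(1) S' pm y in \<open>auto simp: g_def\<close>)
  also have "card (I - Z) = card I - 3"
    using Z by (simp add: card_Diff_subset)
  finally show ?case
    using \<open>card I \<ge> 3\<close> by simp
qed

section \<open>Signs of listings\<close>

lemma atLeast1_double_cases:
  fixes k N :: nat
  assumes "k \<in> {1..2 * N}"
  obtains i where "i \<in> {1..N}" "k = 2 * i - 1" | i where "i \<in> {1..N}" "k = 2 * i"
proof (cases "even k")
  case True
  then obtain i where "k = 2 * i" by blast
  then show ?thesis using assms that(2)[of i] by auto
next
  case False
  then obtain i where "k = 2 * i + 1" by (rule oddE)
  then show ?thesis using assms that(1)[of "Suc i"] by auto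
qed

text \<open>
  Listing the same pairs in another order composes the permutation with two copies of one and the
  same permutation of the pairs, acting on the odd and on the even positions.
\<close>

lemma sign_listing_unique:
  fixes e :: "nat \<Rightarrow> 'a"
  assumes p: "p permutes {1..2 * N}" and p': "p' permutes {1..2 * N}"
    and e: "inj_on e {1..2 * N}"
    and sub: "\<And>i. i \<in> {1..N} \<Longrightarrow> (e (p (2 * i - 1)), e (p (2 * i)))
           \<in> {(e (p' (2 * j - 1)), e (p' (2 * j))) | j. j \<in> {1..N}}"
  shows "sign p = sign p'"
proof -
  have pin: "p k \<in> {1..2 * N}" "p' k \<in> {1..2 * N}" if "k \<in> {1..2 * N}" for k
    using that permutes_in_image[OF p] permutes_in_image[OF p'] by auto
  have "\<forall>i\<in>{1..N}. \<exists>j\<in>{1..N}. p (2 * i - 1) = p' (2 * j - 1) \<and> p (2 * i) = p' (2 * j)"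
  proof
    fix i assume i: "i \<in> {1..N}"
    then obtain j where j: "j \<in> {1..N}" "e (p (2 * i - 1)) = e (p' (2 * j - 1))"
        "e (p (2 * i)) = e (p' (2 * j))"
      using sub by blast
    have k: "2 * i - 1 \<in> {1..2 * N}" "2 * i \<in> {1..2 * N}" "2 * j - 1 \<in> {1..2 * N}" "2 * j \<in> {1..2 * N}"
      using i j by auto
    have "p (2 * i - 1) = p' (2 * j - 1)" "p (2 * i) = p' (2 * j)"
      using j(2) inj_on_eq_iff[OF e pin(1)[OF k(1)] pin(2)[OF k(3)]]
        j(3) inj_on_eq_iff[OF e pin(1)[OF k(2)] pin(2)[OF k(4)]] by simp_all
    then show "\<exists>j\<in>{1..N}. p (2 * i - 1) = p' (2 * j - 1) \<and> p (2 * i) = p' (2 * j)"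
      using j by blast
  qed
  then obtain f where f: "\<And>i. i \<in> {1..N} \<Longrightarrow> f i \<in> {1..N}"
      "\<And>i. i \<in> {1..N} \<Longrightarrow> p (2 * i - 1) = p' (2 * f i - 1)"
      "\<And>i. i \<in> {1..N} \<Longrightarrow> p (2 * i) = p' (2 * f i)"
    unfolding bchoice_iff Bex_def by blast
  have "inj_on f {1..N}"
  proof
    fix i j assume ij: "i \<in> {1..N}" "j \<in> {1..N}" "f i = f j"
    then have "p (2 * i) = p (2 * j)" using f(3)[OF ij(1)] f(3)[OF ij(2)] by simp
    then have "2 * i = 2 * j" by (rule injD[OF permutes_inj[OF p]])
    then show "i = j" by simp
  qed
  then have bij: "bij_betw f {1..N} {1..N}"
    using f(1) by (intro bij_betw_imageI endo_inj_surj) auto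
  define \<psi> where "\<psi> = restrict_id f {1..N}"
  have \<psi>: "\<psi> permutes {1..N}"
    unfolding \<psi>_def by (rule permutes_restrict_id[OF bij])
  have \<psi>f: "\<psi> i = f i" if "i \<in> {1..N}" for i
    using that by (simp add: \<psi>_def)
  define R where "R = map_permutation {1..N} (\<lambda>i. 2 * i - 1) \<psi>"
  define E where "E = map_permutation {1..N} (\<lambda>i. 2 * i) \<psi>"
  have injO: "inj_on (\<lambda>i. 2 * i - 1) {1..N}" and injE: "inj_on (\<lambda>i. 2 * i) {1..N}"
    by (auto simp: inj_on_def)
  have R: "R permutes (\<lambda>i. 2 * i - 1) ` {1..N}" and E: "E permutes (\<lambda>i. 2 * i) ` {1..N}"
    unfolding R_def E_def using injO injE \<psi> by (auto intro!: map_permutation_permutes inj_on_imp_bij_betw)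
  have perm: "permutation R" "permutation E" "permutation p'"
    using R E p' by (auto intro: permutes_imp_permutation[rotated])
  have sgn: "sign R = sign \<psi>" "sign E = sign \<psi>"
    unfolding R_def E_def using injO injE \<psi> by (simp_all add: sign_map_permutation)
  have RE_pair: "R (2 * i - 1) = 2 * f i - 1" "E (2 * i) = 2 * f i"  if "i \<in> {1..N}" for i
    unfolding R_def E_def using that \<psi>f[OF that] 
      map_permutation_apply[OF injO that, of \<psi>] map_permutation_apply[OF injE that, of \<psi>] by auto
  have RE_fixed: "E (2 * i - 1) = 2 * i - 1" "R (2 * i) = 2 * i" if "i \<ge> 1" for i
    using that by (auto intro!: permutes_not_in[OF E] permutes_not_in[OF R], presburger+)
  have "p = p' \<circ> (R \<circ> E)"
  proof
    fix k
    show "p k = (p' \<circ> (R \<circ> E)) k"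
    proof (cases "k \<in> {1..2 * N}")
      case True
      then show ?thesis
      proof (cases rule: atLeast1_double_cases)
        case (1 i)
        then show ?thesis using f(2)[OF 1(1)] RE_pair(1)[OF 1(1)] RE_fixed(1)[of i] by simp
      next
        case (2 i)
        then show ?thesis using f(3)[OF 2(1)] f(1)[OF 2(1)] RE_pair(2)[OF 2(1)] RE_fixed(2)[of "f i"] by simp
      qed
    next
      case False
      then have "k \<notin> (\<lambda>i. 2 * i - 1) ` {1..N}" "k \<notin> (\<lambda>i. 2 * i) ` {1..N}"
        by auto
      then show ?thesis
        using permutes_not_in[OF p False] permutes_not_in[OF p' False]
          permutes_not_in[OF R, of k] permutes_not_in[OF E, of k] by simp
    qed
  qed
  then show ?thesis
    by (simp add: sign_compose permutation_compose perm sgn)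
qed

text \<open>
  Reversing the pairs with index in \<open>B\<close> contributes one transposition for each of them. The pairs
  are numbered from \<open>1\<close>, and \<open>2 * i - 1\<close> is meaningful for \<open>i \<ge> 1\<close> only.
\<close>

lemma exists_pair_swaps:
  fixes B :: "nat set"
  assumes "finite B" "B \<subseteq> {1..N}"
  shows "\<exists>r. r permutes {1..2 * N} \<and> sign r = (-1) ^ card B \<and>
    (\<forall>i\<ge>1. (r (2 * i - 1), r (2 * i)) = (if i \<in> B then (2 * i, 2 * i - 1) else (2 * i - 1, 2 * i)))"
  using assms
proof (induction B)
  case empty
  show ?case by (intro exI[of _ id] conjI permutes_id) auto
next
  case (insert b B)
  then obtain r where r: "r permutes {1..2 * N}" "sign r = (-1) ^ card B"
    "\<And>i. i \<ge> 1 \<Longrightarrow> (r (2 * i - 1), r (2 * i)) = (if i \<in> B then (2 * i, 2 * i - 1) else (2 * i - 1, 2 * i))"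
    by auto
  define t where "t = Transposition.transpose (2 * b - 1) (2 * b)"
  have b: "b \<in> {1..N}" using insert.prems by auto
  have t: "t permutes {1..2 * N}"
    unfolding t_def using b by (intro permutes_swap_id) auto
  have "2 * b - 1 \<noteq> 2 * b"
    using b unfolding atLeastAtMost_iff by linarith
  then have "sign t = -1"
    by (simp add: t_def sign_swap_id)
  moreover have "permutation t" "permutation r"
    using t r by (auto intro: permutes_imp_permutation[rotated])
  ultimately have "sign (t \<circ> r) = (-1) ^ card (insert b B)"
    using insert.hyps r by (simp add: sign_compose)
  moreover have "t \<circ> r permutes {1..2 * N}"
    using r(1) t by (rule permutes_compose)
  moreover have "((t \<circ> r) (2 * i - 1), (t \<circ> r) (2 * i)) =
      (if i \<in> insert b B then (2 * i, 2 * i - 1) else (2 * i - 1, 2 * i))" if i: "i \<ge> 1" for i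
  proof (cases "i = b")
    case True
    then show ?thesis using r(3)[OF i] insert.hyps by (simp add: t_def)
  next
    case False
    then have "2 * i - 1 \<noteq> 2 * b - 1" "2 * i - 1 \<noteq> 2 * b" "2 * i \<noteq> 2 * b - 1" "2 * i \<noteq> 2 * b"
      using i b unfolding atLeastAtMost_iff by (-, presburger+)
    then have "t (2 * i - 1) = 2 * i - 1" "t (2 * i) = 2 * i"
      by (simp_all add: t_def)
    then show ?thesis using r(3)[OF i] False by (auto split: if_splits)
  qed
  ultimately show ?case by blast
qed

section \<open>Complete bipartite graphs\<close>

text \<open>
  The complete bipartite graph with colour classes \<open>u 1, \<dots>, u N\<close> and \<open>w 1, \<dots>, w N\<close>. Its perfect
  matchings correspond to the permutations of \<open>{1..N}\<close>.
\<close>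

locale labelled_complete_bipartite =
  fixes G :: "'a pair_pre_digraph" and N :: nat and u w :: "nat \<Rightarrow> 'a"
  assumes inj_u: "inj_on u {1..N}" and inj_w: "inj_on w {1..N}"
    and disj: "u ` {1..N} \<inter> w ` {1..N} = {}"
    and verts: "pverts G = u ` {1..N} \<union> w ` {1..N}"
    and arcs: "parcs G = u ` {1..N} \<times> w ` {1..N} \<union> w ` {1..N} \<times> u ` {1..N}"
begin

text \<open>
  The perfect matching with edges between \<open>u i\<close> and \<open>w (\<sigma> i)\<close>, as a symmetric set of arcs.
\<close>

definition matching_of :: "(nat \<Rightarrow> nat) \<Rightarrow> 'a rel" where
  "matching_of \<sigma> = (\<Union>i\<in>{1..N}. {(u i, w (\<sigma> i)), (w (\<sigma> i), u i)})"

text \<open>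
  The direction in \<open>D\<close> of the edge between \<open>u i\<close> and \<open>w j\<close>: \<open>1\<close> from \<open>u i\<close> to \<open>w j\<close>, \<open>-1\<close> the other way.
\<close>

definition arc_sign :: "'a rel \<Rightarrow> nat \<Rightarrow> nat \<Rightarrow> int" where
  "arc_sign D i j = (if (u i, w j) \<in> D then 1 else -1)"

lemma u_eq_iff: "i \<in> {1..N} \<Longrightarrow> j \<in> {1..N} \<Longrightarrow> u i = u j \<longleftrightarrow> i = j"
  and w_eq_iff: "i \<in> {1..N} \<Longrightarrow> j \<in> {1..N} \<Longrightarrow> w i = w j \<longleftrightarrow> i = j"
  and u_neq_w: "i \<in> {1..N} \<Longrightarrow> j \<in> {1..N} \<Longrightarrow> u i \<noteq> w j"
    apply (meson inj_u inj_on_eq_iff)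
   apply (meson inj_w inj_on_eq_iff)
  using disj apply blast
  done

lemma card_verts: "card (pverts G) = 2 * N"
  using disj inj_u inj_w by (simp add: verts card_Un_disjoint card_image)

lemma perfect_matching_matching_of:
  assumes "\<sigma> permutes {1..N}"
  shows "perfect_matching G (matching_of \<sigma>)"
proof -
  have \<sigma>: "\<sigma> i \<in> {1..N}" if "i \<in> {1..N}" for i
    using that permutes_in_image[OF assms] by blast
  have \<sigma>_inj: "\<sigma> i = \<sigma> j \<longleftrightarrow> i = j" for i j
    using permutes_inj[OF assms] by (auto dest: injD)
  have "\<exists>!b. (a, b) \<in> matching_of \<sigma>" if a: "a \<in> pverts G" for a
  proof -
    consider i where "i \<in> {1..N}" "a = u i" | j where "j \<in> {1..N}" "a = w j"
      using a unfolding verts by blast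
    then show ?thesis
    proof cases
      case 1
      then have "(a, b) \<in> matching_of \<sigma> \<longleftrightarrow> b = w (\<sigma> i)" for b
        using \<sigma> by (auto simp: matching_of_def u_eq_iff u_neq_w simp del: atLeastAtMost_iff)
      then show ?thesis by simp
    next
      case 2
      then obtain i where i: "i \<in> {1..N}" "j = \<sigma> i"
        using permutes_image[OF assms] by blast
      then have "(a, b) \<in> matching_of \<sigma> \<longleftrightarrow> b = u i" for b
        using 2 \<sigma> by (auto simp: matching_of_def w_eq_iff u_neq_w[symmetric] \<sigma>_inj simp del: atLeastAtMost_iff)
      then show ?thesis by simp
    qed
  qed
  moreover have "matching_of \<sigma> \<subseteq> parcs G"
    using \<sigma> by (auto simp: matching_of_def arcs simp del: atLeastAtMost_iff)
  moreover have "sym (matching_of \<sigma>)"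
    by (auto simp: matching_of_def sym_def)
  ultimately show ?thesis
    by (simp add: perfect_matching_def)
qed

lemma perfect_matchingE:
  assumes "perfect_matching G M"
  obtains \<sigma> where "\<sigma> permutes {1..N}" "M = matching_of \<sigma>"
proof -
  have M: "M \<subseteq> parcs G" and symM: "\<And>a b. (a, b) \<in> M \<Longrightarrow> (b, a) \<in> M"
    and ex: "\<And>a. a \<in> pverts G \<Longrightarrow> \<exists>b. (a, b) \<in> M"
    and uniq: "\<And>a b c. a \<in> pverts G \<Longrightarrow> (a, b) \<in> M \<Longrightarrow> (a, c) \<in> M \<Longrightarrow> b = c"
    using assms unfolding perfect_matching_def sym_def by blast+
  have "\<exists>j\<in>{1..N}. (u i, w j) \<in> M" if i: "i \<in> {1..N}" for i
  proof -
    obtain b where b: "(u i, b) \<in> M" using ex[of "u i"] i by (auto simp: verts)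
    then have "(u i, b) \<in> parcs G" using M by blast
    moreover have "u i \<notin> w ` {1..N}"
      using disj i by blast
    ultimately show ?thesis
      using b by (auto simp: arcs simp del: atLeastAtMost_iff)
  qed
  then obtain f where f: "\<And>i. i \<in> {1..N} \<Longrightarrow> f i \<in> {1..N}" "\<And>i. i \<in> {1..N} \<Longrightarrow> (u i, w (f i)) \<in> M"
    by metis
  have "inj_on f {1..N}"
  proof
    fix i j assume ij: "i \<in> {1..N}" "j \<in> {1..N}" "f i = f j"
    then have "(w (f i), u i) \<in> M" "(w (f i), u j) \<in> M"
      using f(2) symM by metis+
    then have "u i = u j"
      using uniq[of "w (f i)"] f(1)[OF ij(1)] by (auto simp: verts)
    then show "i = j" using ij u_eq_iff by blast
  qed
  then have bij: "bij_betw f {1..N} {1..N}"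
    using f(1) by (intro bij_betw_imageI endo_inj_surj) auto
  define \<sigma> where "\<sigma> = restrict_id f {1..N}"
  have \<sigma>: "\<sigma> permutes {1..N}"
    unfolding \<sigma>_def by (rule permutes_restrict_id[OF bij])
  have \<sigma>f: "\<sigma> i = f i" if "i \<in> {1..N}" for i
    using that by (simp add: \<sigma>_def)
  have uw: "w j = w (f i)" if "(u i, w j) \<in> M" "i \<in> {1..N}" for i j
    using uniq[OF _ that(1) f(2)[OF that(2)]] that(2) by (auto simp: verts)
  have "matching_of \<sigma> \<subseteq> M"
    using f(2) symM \<sigma>f by (auto simp: matching_of_def simp del: atLeastAtMost_iff)
  moreover have "M \<subseteq> matching_of \<sigma>"
  proof (rule subrelI)
    fix a b assume ab: "(a, b) \<in> M"
    then have "(a, b) \<in> parcs G" using M by blast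
    then consider i j where "a = u i" "b = w j" "i \<in> {1..N}" | i j where "a = w j" "b = u i" "i \<in> {1..N}"
      by (auto simp: arcs)
    then show "(a, b) \<in> matching_of \<sigma>"
    proof cases
      case 1
      then have "b = w (\<sigma> i)" using uw ab \<sigma>f by metis
      then show ?thesis using 1 unfolding matching_of_def by blast
    next
      case 2
      then have "a = w (\<sigma> i)" using uw symM[OF ab] \<sigma>f by metis
      then show ?thesis using 2 unfolding matching_of_def by blast
    qed
  qed
  ultimately show ?thesis
    using that[OF \<sigma>] by blast
qed

lemma exists_orientation:
  "\<exists>D. orientation G D \<and> (\<forall>i\<in>{1..N}. \<forall>j\<in>{1..N}. arc_sign D i j = (if P i j then 1 else -1))"
proof -
  define D where "D = {(u i, w j) | i j. i \<in> {1..N} \<and> j \<in> {1..N} \<and> P i j} \<union>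
     {(w j, u i) | i j. i \<in> {1..N} \<and> j \<in> {1..N} \<and> \<not> P i j}"
  have uw: "(u i, w j) \<in> D \<longleftrightarrow> P i j" and wu: "(w j, u i) \<in> D \<longleftrightarrow> \<not> P i j"
    if "i \<in> {1..N}" "j \<in> {1..N}" for i j
    using that u_neq_w[OF that] unfolding D_def
    by (auto simp: u_eq_iff w_eq_iff u_neq_w u_neq_w[symmetric] simp del: atLeastAtMost_iff)
  have "D \<subseteq> parcs G"
    by (auto simp: D_def arcs)
  then have "orientation G D"
    by (auto simp: orientation_def arcs uw wu simp del: atLeastAtMost_iff)
  then show ?thesis
    using uw by (auto simp: arc_sign_def)
qed

text \<open>
  The listing \<open>u 1, w 1, u 2, w 2, \<dots>\<close> of the vertices.
\<close>

lemma reference_listing: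
  assumes e: "vertex_enum G e"
  obtains q where "q permutes {1..2 * N}"
    "\<And>i. i \<in> {1..N} \<Longrightarrow> e (q (2 * i - 1)) = u i" "\<And>i. i \<in> {1..N} \<Longrightarrow> e (q (2 * i)) = w i"
proof -
  have e': "bij_betw e {1..2 * N} (pverts G)"
    using e by (simp add: vertex_enum_def card_verts)
  define f where "f k = (if odd k then u (Suc k div 2) else w (k div 2))" for k
  have fi: "f (2 * i - 1) = u i" "f (2 * i) = w i" if "i \<in> {1..N}" for i
  proof -
    from that obtain i' where "i = Suc i'" by (cases i) auto
    then show "f (2 * i - 1) = u i" "f (2 * i) = w i" by (simp_all add: f_def)
  qed
  have "f ` {1..2 * N} = pverts G"
  proof
    show "f ` {1..2 * N} \<subseteq> pverts G"
    proof
      fix v assume "v \<in> f ` {1..2 * N}"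
      then obtain k where "k \<in> {1..2 * N}" "v = f k" by blast
      then show "v \<in> pverts G"
        by (elim atLeast1_double_cases) (use fi in \<open>auto simp: verts simp del: atLeastAtMost_iff\<close>)
    qed
    have "u i \<in> f ` {1..2 * N} \<and> w i \<in> f ` {1..2 * N}" if "i \<in> {1..N}" for i
    proof -
      have "2 * i - 1 \<in> {1..2 * N}" "2 * i \<in> {1..2 * N}"
        using that by auto
      then show ?thesis
        using fi[OF that] by (metis imageI)
    qed
    then show "pverts G \<subseteq> f ` {1..2 * N}"
      by (auto simp: verts)
  qed
  moreover from this have "inj_on f {1..2 * N}"
    by (intro eq_card_imp_inj_on) (simp_all add: card_verts)
  ultimately have "bij_betw f {1..2 * N} (pverts G)"
    by (simp add: bij_betw_def)
  then have bij: "bij_betw (inv_into {1..2 * N} e \<circ> f) {1..2 * N} {1..2 * N}"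
    using bij_betw_inv_into[OF e'] by (rule bij_betw_trans)
  define q where "q = restrict_id (inv_into {1..2 * N} e \<circ> f) {1..2 * N}"
  have eq: "e (q k) = f k" if "k \<in> {1..2 * N}" for k
  proof -
    have "f k \<in> e ` {1..2 * N}"
      using that \<open>f ` {1..2 * N} = pverts G\<close> e' by (auto simp: bij_betw_def)
    then show ?thesis
      using that by (simp add: q_def f_inv_into_f)
  qed
  show ?thesis
  proof (rule that[of q])
    show "q permutes {1..2 * N}"
      unfolding q_def by (rule permutes_restrict_id[OF bij])
    show "e (q (2 * i - 1)) = u i" "e (q (2 * i)) = w i" if "i \<in> {1..N}" for i
    proof -
      have "2 * i - 1 \<in> {1..2 * N}" "2 * i \<in> {1..2 * N}"
        using that by auto
      then show "e (q (2 * i - 1)) = u i" "e (q (2 * i)) = w i"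
        using eq fi[OF that] by metis+
    qed
  qed
qed

text \<open>
  Up to a factor that depends only on the enumeration, the sign of a perfect matching is a term of
  the Leibniz expansion of the determinant of the matrix of arc signs. A listing arises from the
  reference listing by permuting the vertices \<open>w j\<close> by \<open>\<sigma>\<close> and then reversing the edges that are
  directed from \<open>w\<close> to \<open>u\<close>; any other listing of the same arcs has the same sign.
\<close>

lemma sign_matching_matching_of:
  assumes e: "vertex_enum G e"
  obtains c :: int where "c \<in> {1, -1}"
    "\<And>D \<sigma>. orientation G D \<Longrightarrow> \<sigma> permutes {1..N} \<Longrightarrow>
       sign_matching G e D (matching_of \<sigma>) = c * (sign \<sigma> * (\<Prod>i\<in>{1..N}. arc_sign D i (\<sigma> i)))"
proof -
  obtain q where q: "q permutes {1..2 * N}"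
    "\<And>i. i \<in> {1..N} \<Longrightarrow> e (q (2 * i - 1)) = u i" "\<And>i. i \<in> {1..N} \<Longrightarrow> e (q (2 * i)) = w i"
    using reference_listing[OF e] by blast
  have e': "inj_on e {1..2 * N}"
    using e by (simp add: vertex_enum_def card_verts bij_betw_def)
  have "sign_matching G e D (matching_of \<sigma>) = sign q * (sign \<sigma> * (\<Prod>i\<in>{1..N}. arc_sign D i (\<sigma> i)))"
    if D: "orientation G D" and \<sigma>: "\<sigma> permutes {1..N}" for D \<sigma>
  proof -
    have \<sigma>_in: "\<sigma> i \<in> {1..N}" if "i \<in> {1..N}" for i
      using that permutes_in_image[OF \<sigma>] by blast
    define B where "B = {i\<in>{1..N}. (u i, w (\<sigma> i)) \<notin> D}"
    obtain r where r: "r permutes {1..2 * N}" "sign r = (-1) ^ card B"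
      "\<And>i. i \<ge> 1 \<Longrightarrow> (r (2 * i - 1), r (2 * i)) = (if i \<in> B then (2 * i, 2 * i - 1) else (2 * i - 1, 2 * i))"
    proof -
      have "finite B" "B \<subseteq> {1..N}"
        by (auto simp: B_def)
      from exists_pair_swaps[OF this] show ?thesis
        using that by blast
    qed
    have injE: "inj_on (\<lambda>i. 2 * i) {1..N}"
      by (auto simp: inj_on_def)
    define E where "E = map_permutation {1..N} (\<lambda>i. 2 * i) \<sigma>"
    have E: "E permutes (\<lambda>i. 2 * i) ` {1..N}"
      unfolding E_def using injE \<sigma> by (auto intro!: map_permutation_permutes inj_on_imp_bij_betw)
    have E': "E permutes {1..2 * N}"
      by (rule permutes_subset[OF E]) auto
    have E_even: "E (2 * i) = 2 * \<sigma> i" if "i \<in> {1..N}" for i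
      unfolding E_def using map_permutation_apply[OF injE that] .
    have E_odd: "E (2 * i - 1) = 2 * i - 1" if "i \<in> {1..N}" for i
      using that by (auto intro!: permutes_not_in[OF E], presburger)
    have sE: "sign E = sign \<sigma>"
      unfolding E_def using injE \<sigma> by (simp add: sign_map_permutation)
    define p where "p = q \<circ> (E \<circ> r)"
    have p: "p permutes {1..2 * N}"
      unfolding p_def using q(1) E' r(1) by (intro permutes_compose)
    have perm: "permutation q" "permutation E" "permutation r"
      using q(1) E' r(1) by (auto intro: permutes_imp_permutation[rotated])
    have pairs: "(e (p (2 * i - 1)), e (p (2 * i))) =
        (if (u i, w (\<sigma> i)) \<in> D then (u i, w (\<sigma> i)) else (w (\<sigma> i), u i))" if i: "i \<in> {1..N}" for i
      using r(3)[of i] i E_even[OF i] E_odd[OF i] q(2)[OF i] q(3)[OF \<sigma>_in[OF i]]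
      by (auto simp: p_def B_def split: if_splits)
    have "(u i, w (\<sigma> i)) \<in> D \<longleftrightarrow> (w (\<sigma> i), u i) \<notin> D" if "i \<in> {1..N}" for i
      using D that \<sigma>_in[OF that] unfolding orientation_def arcs by fastforce
    then have "{(u i, w (\<sigma> i)), (w (\<sigma> i), u i)} \<inter> D = {(e (p (2 * i - 1)), e (p (2 * i)))}"
      if "i \<in> {1..N}" for i
      unfolding pairs[OF that] using that by auto
    then have "matching_of \<sigma> \<inter> D = (\<Union>i\<in>{1..N}. {(e (p (2 * i - 1)), e (p (2 * i)))})"
      unfolding matching_of_def UN_extend_simps by (intro SUP_cong refl)
    then have MD: "matching_of \<sigma> \<inter> D = {(e (p (2 * i - 1)), e (p (2 * i))) | i. i \<in> {1..N}}"
      by blast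
    have lp: "listing_perm G e D (matching_of \<sigma>) p"
      using p MD by (simp add: listing_perm_def card_verts)
    define p' where "p' = (SOME p. listing_perm G e D (matching_of \<sigma>) p)"
    have lp': "listing_perm G e D (matching_of \<sigma>) p'"
      unfolding p'_def by (rule someI[of "listing_perm G e D (matching_of \<sigma>)", OF lp])
    have "sign p' = sign p"
    proof (rule sign_listing_unique[OF _ p e'])
      show "p' permutes {1..2 * N}"
        using lp' by (simp add: listing_perm_def card_verts)
      show "(e (p' (2 * i - 1)), e (p' (2 * i))) \<in> {(e (p (2 * j - 1)), e (p (2 * j))) | j. j \<in> {1..N}}"
        if "i \<in> {1..N}" for i
        using lp' that unfolding MD[symmetric] by (auto simp: listing_perm_def card_verts)
    qed
    also have "\<dots> = sign q * (sign \<sigma> * (-1) ^ card B)"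
      by (simp add: p_def sign_compose permutation_compose perm sE r(2))
    also have "(\<Prod>i\<in>{1..N}. arc_sign D i (\<sigma> i)) = (\<Prod>i\<in>B. -1)"
      by (rule prod.mono_neutral_cong_right) (auto simp: B_def arc_sign_def)
    then have "(-1) ^ card B = (\<Prod>i\<in>{1..N}. arc_sign D i (\<sigma> i))"
      by simp
    finally show ?thesis
      by (simp add: sign_matching_def p'_def)
  qed
  moreover have "sign q \<in> {1, -1}"
    by (simp add: sign_def)
  ultimately show ?thesis
    using that by blast
qed

end

lemma complete_bipartite_labelling:
  assumes "complete_bipartite_digraph N N (with_proj G)" "N > 0"
  shows "\<exists>u w. labelled_complete_bipartite G N u w"
proof -
  obtain U W where UW: "pverts G = U \<union> W" "U \<inter> W = {}" "card U = N" "card W = N"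
    "parcs G = U \<times> W \<union> W \<times> U"
    using assms(1) unfolding complete_bipartite_digraph_pair_def by blast
  have "finite U" "finite W"
    using UW assms(2) by (auto intro: card_ge_0_finite)
  then obtain u w where "bij_betw u {1..N} U" "bij_betw w {1..N} W"
    using UW(3,4) ex_bij_betw_nat_finite_1 by metis
  then have "labelled_complete_bipartite G N u w"
    using UW by unfold_locales (auto simp: bij_betw_def)
  then show ?thesis by blast
qed

section \<open>The pfaffian number of a complete bipartite graph\<close>

text \<open>
  The sign of a permutation is a combination of products of signs. For a fixed permutation \<open>\<tau>\<close>
  the alternating sum over \<open>B \<subseteq> S\<close> factors as a product over \<open>j \<in> S\<close> whose factor is \<open>2\<close> if
  \<open>\<sigma> j = \<tau> j\<close> and \<open>0\<close> otherwise, so it vanishes unless \<open>\<sigma> = \<tau>\<close>.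
\<close>

lemma signed_permutation_products_span_one:
  fixes \<sigma> :: "'a \<Rightarrow> 'a"
  assumes S: "finite S" and \<sigma>: "\<sigma> permutes S"
  shows "(\<Sum>(\<tau>, B)\<in>{\<tau>. \<tau> permutes S} \<times> Pow S. (of_int (sign \<tau>) * (-1) ^ card B / 2 ^ card S) *
           (of_int (sign \<sigma>) * (\<Prod>j\<in>S. if j \<in> B \<and> \<sigma> j = \<tau> j then -1 else 1))) = (1 :: real)"
proof -
  have inner: "(\<Sum>B\<in>Pow S. (-1) ^ card B * (\<Prod>j\<in>S. if j \<in> B \<and> \<sigma> j = \<tau> j then -1 else 1)) =
      (if \<tau> = \<sigma> then 2 ^ card S else (0 :: real))" if \<tau>: "\<tau> permutes S" for \<tau>
  proof -
    have "(-1) ^ card B * (\<Prod>j\<in>S. if j \<in> B \<and> \<sigma> j = \<tau> j then -1 else 1) =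
        (\<Prod>j\<in>B. if \<sigma> j = \<tau> j then 1 else (-1 :: real))" if "B \<in> Pow S" for B
    proof -
      have "(\<Prod>j\<in>S. if j \<in> B \<and> \<sigma> j = \<tau> j then -1 else (1 :: real)) =
          (\<Prod>j\<in>B. if \<sigma> j = \<tau> j then -1 else 1)"
        by (rule prod.mono_neutral_cong_right) (use S that in auto)
      then have "(-1) ^ card B * (\<Prod>j\<in>S. if j \<in> B \<and> \<sigma> j = \<tau> j then -1 else (1 :: real)) =
          (\<Prod>j\<in>B. -1 * (if \<sigma> j = \<tau> j then -1 else 1))"
        by (simp only: prod.distrib prod_constant)
      also have "\<dots> = (\<Prod>j\<in>B. if \<sigma> j = \<tau> j then 1 else -1)"
        by (rule prod.cong) auto
      finally show ?thesis .
    qed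
    then have "(\<Sum>B\<in>Pow S. (-1) ^ card B * (\<Prod>j\<in>S. if j \<in> B \<and> \<sigma> j = \<tau> j then -1 else 1)) =
        (\<Sum>B\<in>Pow S. (\<Prod>j\<in>B. if \<sigma> j = \<tau> j then 1 else (-1 :: real)) * (\<Prod>j\<in>S - B. 1))"
      by (intro sum.cong) simp_all
    also have "\<dots> = (\<Prod>j\<in>S. (if \<sigma> j = \<tau> j then 1 else -1) + 1)"
      by (rule prod_add[OF S, symmetric])
    also have "\<dots> = (if \<tau> = \<sigma> then 2 ^ card S else 0)"
    proof (cases "\<tau> = \<sigma>")
      case False
      then obtain j where j: "\<sigma> j \<noteq> \<tau> j" by (metis ext)
      then have "j \<in> S" using \<sigma> \<tau> by (metis permutes_not_in)
      then show ?thesis using S j False by (auto intro!: prod_zero)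
    qed simp
    finally show ?thesis .
  qed
  have "(\<Sum>(\<tau>, B)\<in>{\<tau>. \<tau> permutes S} \<times> Pow S. (of_int (sign \<tau>) * (-1) ^ card B / 2 ^ card S) *
           (of_int (sign \<sigma>) * (\<Prod>j\<in>S. if j \<in> B \<and> \<sigma> j = \<tau> j then -1 else 1))) =
      (\<Sum>\<tau> | \<tau> permutes S. of_int (sign \<tau>) * of_int (sign \<sigma>) / 2 ^ card S *
        (\<Sum>B\<in>Pow S. (-1) ^ card B * (\<Prod>j\<in>S. if j \<in> B \<and> \<sigma> j = \<tau> j then -1 else (1 :: real))))"
    by (simp add: sum.cartesian_product[symmetric] sum_distrib_left mult_ac)
  also have "\<dots> = (\<Sum>\<tau> | \<tau> permutes S. if \<tau> = \<sigma> then 1 else 0)"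
    by (rule sum.cong) (simp_all add: inner flip: of_int_mult)
  also have "\<dots> = 1"
    using finite_permutations[OF S] \<sigma> by simp
  finally show ?thesis .
qed

context labelled_complete_bipartite
begin

lemma k_pfaffian_lower_bound:
  assumes "N = 3 * n" and "k_pfaffian G k"
  shows "3 * n + 1 \<le> k"
proof -
  obtain e Ds x where e: "vertex_enum G e" and Ds: "k_orientation G k Ds"
    and x: "\<And>M. perfect_matching G M \<Longrightarrow> (\<Sum>i<k. signature G e Ds M i * x i) = 1"
    using assms(2) unfolding k_pfaffian_def pfaffian_orientation_def by blast
  obtain c :: int where c: "\<And>D \<sigma>. orientation G D \<Longrightarrow> \<sigma> permutes {1..N} \<Longrightarrow>
       sign_matching G e D (matching_of \<sigma>) = c * (sign \<sigma> * (\<Prod>i\<in>{1..N}. arc_sign D i (\<sigma> i)))"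
    by (rule sign_matching_matching_of[OF e]) (rule that)
  have D: "orientation G (Ds ! i)" if "i < k" for i
    using Ds that by (auto simp: k_orientation_def)
  have "3 * n + 1 \<le> card {..<k}"
  proof (rule signed_permutation_products_lower_bound
      [where S = "{1..N}" and s = "\<lambda>i j l. of_int (arc_sign (Ds ! i) j l)" and x = "\<lambda>i. of_int c * x i"])
    show "of_int (arc_sign (Ds ! i) j l) \<in> {1, -1 :: real}" for i j l
      by (simp add: arc_sign_def)
    fix \<sigma> assume \<sigma>: "\<sigma> permutes {1..N}"
    have "(\<Sum>i<k. of_int c * x i * (of_int (sign \<sigma>) * (\<Prod>j\<in>{1..N}. of_int (arc_sign (Ds ! i) j (\<sigma> j)))))
        = (\<Sum>i<k. signature G e Ds (matching_of \<sigma>) i * x i)"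
      by (rule sum.cong) (simp_all add: signature_def c[OF D \<sigma>])
    then show "(\<Sum>i<k. of_int c * x i * (of_int (sign \<sigma>) * (\<Prod>j\<in>{1..N}. of_int (arc_sign (Ds ! i) j (\<sigma> j))))) = 1"
      using x[OF perfect_matching_matching_of[OF \<sigma>]] by simp
  qed (use assms in auto)
  then show ?thesis by simp
qed

text \<open>
  Some \<open>k\<close> works, so the least element in the definition of \<open>pf\<close> exists. There is one orientation
  for each pair \<open>\<kappa>\<close> of a permutation \<open>\<tau>\<close> and a set \<open>B\<close>; it directs all edges from \<open>u\<close> to \<open>w\<close> except
  those between \<open>u i\<close> and \<open>w (\<tau> i)\<close> for \<open>i \<in> B\<close>.
\<close>

lemma exists_k_pfaffian:
  "\<exists>k>0. k_pfaffian G k"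
proof -
  have "finite (pverts G)" by (simp add: verts)
  then obtain e where e: "vertex_enum G e"
    unfolding vertex_enum_def using ex_bij_betw_nat_finite_1 by blast
  obtain c :: int where c1: "c \<in> {1, -1}" and c: "\<And>D \<sigma>. orientation G D \<Longrightarrow> \<sigma> permutes {1..N} \<Longrightarrow>
       sign_matching G e D (matching_of \<sigma>) = c * (sign \<sigma> * (\<Prod>i\<in>{1..N}. arc_sign D i (\<sigma> i)))"
    using sign_matching_matching_of[OF e] by blast
  define K where "K = {\<tau>. \<tau> permutes {1..N}} \<times> Pow {1..N}"
  have "finite K"
    by (simp add: K_def finite_permutations)
  then obtain ks where ks: "set ks = K" "distinct ks"
    using finite_distinct_list by blast
  have "\<forall>\<kappa>. \<exists>D. orientation G D \<and> (\<forall>i\<in>{1..N}. \<forall>j\<in>{1..N}.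
      arc_sign D i j = (if \<not> (i \<in> snd \<kappa> \<and> j = fst \<kappa> i) then 1 else -1))"
    by (intro allI exists_orientation)
  then obtain D where D: "\<And>\<kappa>. orientation G (D \<kappa>)"
    "\<And>\<kappa> i j. i \<in> {1..N} \<Longrightarrow> j \<in> {1..N} \<Longrightarrow>
       arc_sign (D \<kappa>) i j = (if \<not> (i \<in> snd \<kappa> \<and> j = fst \<kappa> i) then 1 else -1)"
    by metis
  define a where "a \<kappa> = of_int (sign (fst \<kappa>)) * (-1) ^ card (snd \<kappa>) / (2 :: real) ^ N"
    for \<kappa> :: "(nat \<Rightarrow> nat) \<times> nat set"
  have "(\<Sum>i<length ks. signature G e (map D ks) M i * (of_int c * a (ks ! i))) = 1"
    if M: "perfect_matching G M" for M
  proof -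
    obtain \<sigma> where \<sigma>: "\<sigma> permutes {1..N}" and M\<sigma>: "M = matching_of \<sigma>"
      using M by (rule perfect_matchingE)
    define F where "F \<kappa> = a \<kappa> * (of_int (sign \<sigma>) *
        (\<Prod>j\<in>{1..N}. if j \<in> snd \<kappa> \<and> \<sigma> j = fst \<kappa> j then -1 else 1))" for \<kappa>
    have "signature G e (map D ks) M i * (of_int c * a (ks ! i)) = F (ks ! i)" if i: "i < length ks" for i
    proof -
      have "(\<Prod>j\<in>{1..N}. arc_sign (D (ks ! i)) j (\<sigma> j)) =
          (\<Prod>j\<in>{1..N}. if j \<in> snd (ks ! i) \<and> \<sigma> j = fst (ks ! i) j then -1 else 1)"
        by (rule prod.cong) (use permutes_in_image[OF \<sigma>] in \<open>simp_all add: D(2) del: atLeastAtMost_iff\<close>)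
      moreover have "real_of_int (\<Prod>j\<in>{1..N}. if j \<in> snd (ks ! i) \<and> \<sigma> j = fst (ks ! i) j then -1 else 1) =
          (\<Prod>j\<in>{1..N}. if j \<in> snd (ks ! i) \<and> \<sigma> j = fst (ks ! i) j then -1 else 1)"
        unfolding of_int_prod by (rule prod.cong) auto
      ultimately show ?thesis
        using i c1 by (auto simp: F_def signature_def M\<sigma> c[OF D(1) \<sigma>])
    qed
    then have "(\<Sum>i<length ks. signature G e (map D ks) M i * (of_int c * a (ks ! i))) = (\<Sum>i<length ks. F (ks ! i))"
      by simp
    also have "\<dots> = (\<Sum>\<kappa>\<in>K. F \<kappa>)"
      by (rule sum.reindex_bij_betw) (use bij_betw_nth[OF ks(2)] ks(1) in auto)
    also have "\<dots> = 1"
      using signed_permutation_products_span_one[OF _ \<sigma>]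
      by (simp add: K_def F_def a_def case_prod_unfold)
    finally show ?thesis .
  qed
  moreover have "k_orientation G (length ks) (map D ks)"
    using D(1) by (auto simp: k_orientation_def)
  ultimately have "pfaffian_orientation G e (length ks) (map D ks)"
    unfolding pfaffian_orientation_def by (intro conjI exI allI impI)
  then have "k_pfaffian G (length ks)"
    unfolding k_pfaffian_def using e by blast
  moreover have "(id, {}) \<in> K"
    by (simp add: K_def permutes_id)
  then have "length ks > 0"
    using ks(1) by auto
  ultimately show ?thesis by blast
qed

end

lemma pf_complete_bipartite_ge:
  assumes "complete_bipartite_digraph (3 * n) (3 * n) (with_proj G)" "n > 0"
  shows "3 * n + 1 \<le> pf G"
proof -
  obtain u w where "labelled_complete_bipartite G (3 * n) u w"
    using complete_bipartite_labelling[OF assms(1)] assms(2) by auto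
  then interpret labelled_complete_bipartite G "3 * n" u w .
  obtain k where "k > 0 \<and> k_pfaffian G k"
    using exists_k_pfaffian by blast
  then have "k_pfaffian G (pf G)"
    unfolding pf_def by (metis (mono_tags, lifting) LeastI)
  then show ?thesis
    using k_pfaffian_lower_bound by blast
qed

lemma exists_complete_bipartite_nat:
  "\<exists>G :: nat pair_pre_digraph. complete_bipartite_digraph m m (with_proj G)"
proof -
  define G :: "nat pair_pre_digraph" where
    "G = \<lparr>pverts = {..<m} \<union> {m..<2 * m}, parcs = {..<m} \<times> {m..<2 * m} \<union> {m..<2 * m} \<times> {..<m}\<rparr>"
  have "complete_bipartite_digraph m m (with_proj G)"
    unfolding complete_bipartite_digraph_pair_def
    by (intro conjI exI[of _ "{..<m}"] exI[of _ "{m..<2 * m}"]) (auto simp: G_def)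
  then show ?thesis by blast
qed

theorem mainTheorem5:
  shows "(\<forall>n::nat. n > 0 \<longrightarrow>
            (\<forall>G :: 'a pair_pre_digraph.
               complete_bipartite_digraph (3 * n) (3 * n) (with_proj G) \<longrightarrow> pf G \<ge> 3 * n + 1)) \<and>
         (\<forall>N::int. \<exists>G :: nat pair_pre_digraph. pair_graph G \<and> int (pf G) \<ge> N)"
proof (intro conjI allI impI)
  fix n :: nat and G :: "'a pair_pre_digraph"
  assume "n > 0" "complete_bipartite_digraph (3 * n) (3 * n) (with_proj G)"
  then show "pf G \<ge> 3 * n + 1"
    using pf_complete_bipartite_ge by blast
next
  fix N :: int
  define n where "n = nat N + 1"
  obtain G :: "nat pair_pre_digraph" where G: "complete_bipartite_digraph (3 * n) (3 * n) (with_proj G)"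
    using exists_complete_bipartite_nat by blast
  have "3 * n + 1 \<le> pf G"
    by (rule pf_complete_bipartite_ge[OF G]) (simp add: n_def)
  then have "int (pf G) \<ge> N"
    by (simp add: n_def)
  then show "\<exists>G :: nat pair_pre_digraph. pair_graph G \<and> int (pf G) \<ge> N"
    using pair_graphI_complete_bipartite[OF G] by blast
qed

end
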